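(* Consider an original dense block and a lightweight dense block (LDB) with the same parameters: $L$ is the number of convolutional layers in the block, $M$ the number of channels of the input data, $N$ the number of kernels in each layer, $H$ the computing cost of each channel of each kernel, and $S$ the weight size of each channel of each kernel. Let $C_{\mathrm{Dense}}, C_{\mathrm{LDB}}$ denote the total computing costs and $W_{\mathrm{Dense}}, W_{\mathrm{LDB}}$ the total weight sizes of the two blocks, as defined in the context. Then, compared with the original dense block, the LDB reduces the computing cost and the weight size to a fraction in $(1/L, 2/L)$, that is, $$\frac{C_{\mathrm{LDB}}}{C_{\mathrm{Dense}}}\in\left(\frac{1}{L},\frac{2}{L}\right)\qquad\text{and}\qquad \frac{W_{\mathrm{LDB}}}{W_{\mathrm{Dense}}}\in\left(\frac{1}{L},\frac{2}{L}\right).$$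
   Context: A block consists of $L$ convolutional layers, numbered $1,\dots,L$. The input $X_0$ of the block has $M$ channels. Each layer has $N$ kernels, so the output $X_i$ of layer $i$ has $N$ channels. Each kernel of a layer has as many channels as the input of that layer. The quantities $L$, $M$, $N$ are counts (positive integers), and $H$, $S$ are positive per-channel, per-kernel costs. Original dense block: the input of layer $i$ is the concatenation of all preceding features, $X_i=\phi([X_0,X_1,\dots,X_{i-1}])$, where $\phi$ denotes the convolutional layer. Concatenation adds the numbers of channels, so the number of input channels of layer $i$ is $c_i^{\mathrm{Dense}}=M+(i-1)N$ for $1\le i\le L$. Lightweight dense block (LDB): $X_1=\phi(X_0)$ and, for $i>1$, $X_i=\phi(X_1+\dots+X_{i-1})$. Summation preserves the number of channels, so the number of input channels of layer $i$ is $c_1^{\mathrm{LDB}}=M$ and $c_i^{\mathrm{LDB}}=N$ for $2\le i\le L$. The output of the block is obtained by concatenating the features of all its layers. Cost model: only the convolution kernels are counted; the cost of the concatenation and summation operations is excluded. The total computing cost of a block is the sum over its layers of $H$ times (number of kernels) times (number of input channels), and the total weight size is the same with $S$ in place of $H$. Thus, for $\ast\in\{\mathrm{Dense},\mathrm{LDB}\}$, $$C_{\ast}=\sum_{i=1}^{L} H\,N\,c_i^{\ast},\qquad W_{\ast}=\sum_{i=1}^{L} S\,N\,c_i^{\ast}.$$ Explicitly, $C_{\mathrm{Dense}}=HN\left(ML+NL(L-1)/2\right)$ and $C_{\mathrm{LDB}}=HN\left(M+N(L-1)\right)$.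
   Formalization: The number of layers L is assumed to be at least 2: for L = 1 the two blocks coincide, so both ratios equal 1, which is not in the open interval (1, 2), and the claim as stated fails. *)

theory Defs
  imports Complex_Main
begin

text \<open>Channel counts and costs of convolutional blocks with \<open>L\<close> layers numbered from 1,
  \<open>M\<close> input channels and \<open>N\<close> kernels per layer. The index \<open>i = 0\<close> of
  \<open>feature_channels\<close> is the input of the block; for the other functions \<open>i\<close> is meant to range
  over \<open>{1..L}\<close>, so the subtraction on \<open>nat\<close> below does not truncate.\<close>

definition feature_channels :: "nat \<Rightarrow> nat \<Rightarrow> nat \<Rightarrow> nat" where
  "feature_channels M N i = (if i = 0 then M else N)"

definition dense_in_channels :: "nat \<Rightarrow> nat \<Rightarrow> nat \<Rightarrow> nat" where
  "dense_in_channels M N i = M + (i - 1) * N"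

definition ldb_in_channels :: "nat \<Rightarrow> nat \<Rightarrow> nat \<Rightarrow> nat" where
  "ldb_in_channels M N i = (if i = 1 then M else N)"

text \<open>Layer \<open>i\<close> of the dense block reads the concatenation of features \<open>0, \<dots>, i - 1\<close>, whose
  channel counts add up. Layer \<open>i > 1\<close> of the lightweight block reads the sum of features
  \<open>1, \<dots>, i - 1\<close>, which has the channel count common to all of them.\<close>

lemma dense_in_channels_concat:
  "1 \<le> i \<Longrightarrow> dense_in_channels M N i = (\<Sum>j<i. feature_channels M N j)"
  by (induction i rule: nat_induct_at_least)
     (auto simp: dense_in_channels_def feature_channels_def algebra_simps Suc_diff_le
           dest!: Suc_le_D)

lemma ldb_in_channels_first: "ldb_in_channels M N 1 = feature_channels M N 0"
  by (simp add: ldb_in_channels_def feature_channels_def)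

lemma ldb_in_channels_sum:
  "1 \<le> j \<Longrightarrow> j < i \<Longrightarrow> ldb_in_channels M N i = feature_channels M N j"
  by (simp add: ldb_in_channels_def feature_channels_def)

text \<open>Total cost of a block whose layer \<open>i\<close> has \<open>c i\<close> input channels, at cost \<open>k\<close> per channel of
  each kernel. The cost is the computing cost for \<open>k = H\<close> and the weight size for \<open>k = S\<close>.\<close>

definition block_cost :: "nat \<Rightarrow> nat \<Rightarrow> (nat \<Rightarrow> nat) \<Rightarrow> real \<Rightarrow> real" where
  "block_cost L N c k = (\<Sum>i=1..L. k * real N * real (c i))"

definition C_Dense :: "nat \<Rightarrow> nat \<Rightarrow> nat \<Rightarrow> real \<Rightarrow> real" where
  "C_Dense L M N H = block_cost L N (dense_in_channels M N) H"

definition C_LDB :: "nat \<Rightarrow> nat \<Rightarrow> nat \<Rightarrow> real \<Rightarrow> real" where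
  "C_LDB L M N H = block_cost L N (ldb_in_channels M N) H"

definition W_Dense :: "nat \<Rightarrow> nat \<Rightarrow> nat \<Rightarrow> real \<Rightarrow> real" where
  "W_Dense L M N S = block_cost L N (dense_in_channels M N) S"

definition W_LDB :: "nat \<Rightarrow> nat \<Rightarrow> nat \<Rightarrow> real \<Rightarrow> real" where
  "W_LDB L M N S = block_cost L N (ldb_in_channels M N) S"

text \<open>With a single layer the two blocks coincide. Their cost ratio is then 1, which is not in the
  open interval from \<open>1 / L = 1\<close> to \<open>2 / L = 2\<close>, so a comparison with strict bounds
  needs \<open>L \<ge> 2\<close>.\<close>

lemma single_layer_coincide:
  "C_LDB 1 M N H = C_Dense 1 M N H" "W_LDB 1 M N S = W_Dense 1 M N S"
  by (simp_all add: C_LDB_def C_Dense_def W_LDB_def W_Dense_def block_cost_def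
        ldb_in_channels_def dense_in_channels_def)

end

theory Submission
  imports Defs
begin

text \<open>Both cost notions are \<open>block_cost\<close> with a different unit cost
  \<open>k\<close>, so \<open>block_cost_ratio\<close> settles both. With \<open>A = M\<close> and
  \<open>B = N * (L - 1)\<close>, the closed forms of the two sums are
  \<open>k * N * (A + B)\<close> and \<open>k * N * L * (A + B / 2)\<close>. The ratio is thus
  \<open>1 / L\<close> times \<open>(A + B) / (A + B / 2)\<close>, a factor strictly between 1 and 2
  for positive \<open>A\<close> and \<open>B\<close>.\<close>

lemma block_cost_dense:
  "block_cost L N (dense_in_channels M N) k =
    k * real N * (real L * real M + real N * (real L * (real L - 1) / 2))"
  by (induction L)
     (simp_all add: block_cost_def dense_in_channels_def field_simps)

text \<open>Only the first layer sees \<open>M\<close> channels. For \<open>L = 0\<close> the sum is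
  empty while the right side is \<open>k * N * (M - N)\<close>, so the induction starts at
  1.\<close>

lemma block_cost_ldb:
  assumes "1 \<le> L"
  shows "block_cost L N (ldb_in_channels M N) k = k * real N * (real M + real N * (real L - 1))"
  using assms
  by (induction L rule: nat_induct_at_least)
     (simp_all add: block_cost_def ldb_in_channels_def algebra_simps)

lemma block_cost_ratio:
  assumes "L \<ge> 2" and "M > 0" and "N > 0" and "k > 0"
  shows "block_cost L N (ldb_in_channels M N) k / block_cost L N (dense_in_channels M N) k
    \<in> {1 / real L <..< 2 / real L}"
proof -
  define A where "A = real M"
  define B where "B = real N * (real L - 1)"
  \<comment> \<open>\<open>B > 0\<close> is where \<open>L \<ge> 2\<close> enters.\<close>
  have pos: "real L > 0" "k * real N > 0" "A > 0" "B > 0"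
    using assms by (simp_all add: A_def B_def)
  have dense: "block_cost L N (dense_in_channels M N) k = k * real N * (real L * (A + B / 2))"
    unfolding block_cost_dense A_def B_def by (simp add: algebra_simps)
  have ldb: "block_cost L N (ldb_in_channels M N) k = k * real N * (A + B)"
    using assms by (simp add: block_cost_ldb A_def B_def)
  have "block_cost L N (ldb_in_channels M N) k / block_cost L N (dense_in_channels M N) k
      = (A + B) / (A + B / 2) / real L"
    unfolding dense ldb using assms pos
    by (subst mult_divide_mult_cancel_left) (simp_all add: mult.commute)
  \<comment> \<open>After clearing the denominator, the lower bound amounts to \<open>B > 0\<close>
    and the upper bound to \<open>A > 0\<close>.\<close>
  moreover have "1 < (A + B) / (A + B / 2)" and "(A + B) / (A + B / 2) < 2"
    using pos by (simp_all add: less_divide_eq divide_less_eq)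
  \<comment> \<open>The deleted simp rule would merge the nested quotient and hide the common
    divisor \<open>real L\<close>.\<close>
  ultimately show ?thesis
    using pos by (simp add: divide_strict_right_mono del: divide_divide_eq_left)
qed

theorem theorem1:
  fixes L M N :: nat and H S :: real
  assumes "L \<ge> 2" and "M > 0" and "N > 0" and "H > 0" and "S > 0"
  shows "C_LDB L M N H / C_Dense L M N H \<in> {1 / real L <..< 2 / real L}
    \<and> W_LDB L M N S / W_Dense L M N S \<in> {1 / real L <..< 2 / real L}"
  unfolding C_LDB_def C_Dense_def W_LDB_def W_Dense_def
  using assms by (blast intro: block_cost_ratio)

end
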